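(* Let $m\ge 0$ and let $\mathbf{w}(t)=\sum_{k=0}^m \mathbf{c}_k L_k(t)$ be a nonzero complex pre-image polynomial, with $\mathbf{c}_k=c_{k,1}+\mathrm{i}\,c_{k,2}\in\mathbb{C}$, generating the planar Pythagorean-hodograph curve $\mathbf{r}(t)$, $t\in[0,1]$, with $\mathbf{r}(0)=0$ and $\mathbf{r}'(t)=\mathbf{w}^2(t)$. Let $S$ be the arc length of $\mathbf{r}$. Set $\mathbf{a}=(c_{0,1},c_{0,2},c_{1,1},c_{1,2},\dots,c_{m,1},c_{m,2})^T\in\mathbb{R}^{2m+2}$, $\mathbf{g}=\mathbf{a}+\mathrm{sign}(c_{0,1})\,\|\mathbf{a}\|_2\,(1,0,\dots,0)^T$, and $Q=I-\frac{2}{\mathbf{g}^T\mathbf{g}}\,\mathbf{g}\mathbf{g}^T=(q_{j,k})_{j,k=1}^{2m+2}$. For $k=1,\dots,2m+1$ define $$\mathbf{b}_k(t)=\sum_{j=0}^m \mathbf{b}_{k,j}L_j(t),\qquad \mathbf{b}_{k,j}=q_{2j+1,k+1}+\mathrm{i}\,q_{2j+2,k+1}.$$ For real numbers $\gamma_1,\dots,\gamma_{2m+1}$ let $\delta\mathbf{w}(t)=\sum_{k=1}^{2m+1}\gamma_k\mathbf{b}_k(t)$. Then: (1) $S=\|\mathbf{w}\|^2$. (2) $\delta\mathbf{w}$ is orthogonal to $\mathbf{w}$ and $\|\delta\mathbf{w}\|=\sqrt{\gamma_1^2+\cdots+\gamma_{2m+1}^2}$. (3) If $\delta S>0$ and $\gamma_1^2+\cdots+\gamma_{2m+1}^2=\delta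 S$, then the pre-image polynomial $\mathbf{w}(t)+\delta\mathbf{w}(t)$ generates a Pythagorean-hodograph curve of arc length $S+\delta S$. (4) Suppose $\mathbf{r}(1)=1$. Then the curve generated by $\mathbf{w}+\delta\mathbf{w}$, starting at $0$, has the same end points as $\mathbf{r}$ if and only if $$\sum_{j,k=1}^{2m+1}\mathbf{f}_{j,k}\,\gamma_j\gamma_k+\sum_{k=1}^{2m+1}\mathbf{f}_k\,\gamma_k=0,\qquad \mathbf{f}_{j,k}=\sum_{\ell=0}^m\mathbf{b}_{j,\ell}\,\mathbf{b}_{k,\ell},\quad \mathbf{f}_k=2\sum_{\ell=0}^m\mathbf{b}_{k,\ell}\,\mathbf{c}_\ell.$$
   Context: Points $(x,y)$ of the plane are identified with complex numbers $x+\mathrm{i}y$. For complex polynomials $\mathbf{u},\mathbf{v}$ in the real variable $t\in[0,1]$, $\langle\mathbf{u},\mathbf{v}\rangle=\int_0^1\mathbf{u}(t)\overline{\mathbf{v}(t)}\,dt$ and $\|\mathbf{u}\|=\sqrt{\langle\mathbf{u},\mathbf{u}\rangle}$; $\mathbf{u}$ and $\mathbf{v}$ are called orthogonal if $\mathrm{Re}\,\langle\mathbf{u},\mathbf{v}\rangle=0$. $\|\cdot\|_2$ is the standard Euclidean norm. The Pythagorean-hodograph (PH) curve generated by a pre-image polynomial $\mathbf{w}$ is $\mathbf{r}(t)=\int_0^t\mathbf{w}^2(\tau)\,d\tau$ (integration constant $\mathbf{r}(0)=0$); its arc length is $\int_0^1|\mathbf{r}'(t)|\,dt$. $L_k$ are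 the real orthonormal Legendre polynomials on $[0,1]$: $L_k(t)=\sqrt{2k+1}\sum_{i=0}^k(-1)^{k+i}\binom{k}{i}b_i^k(t)$ with $b_i^k(t)=\binom{k}{i}(1-t)^{k-i}t^i$, satisfying $\int_0^1L_jL_k\,dt=\delta_{jk}$. Convention: $\mathrm{sign}(x)=1$ for $x\ge0$ and $\mathrm{sign}(x)=-1$ for $x<0$. *)

theory Defs
  imports "HOL-Analysis.Analysis" "Jordan_Normal_Form.Matrix"
begin

text \<open>Complex polynomials in the real variable \<open>t\<close> are represented by the functions
  \<open>real \<Rightarrow> complex\<close> they induce.\<close>

definition l2_inner :: "(real \<Rightarrow> complex) \<Rightarrow> (real \<Rightarrow> complex) \<Rightarrow> complex" where
  "l2_inner u v = integral {0..1} (\<lambda>t. u t * cnj (v t))"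

text \<open>\<open>l2_inner u u\<close> is real and nonnegative; \<open>Re\<close> only serves as the coercion to \<open>real\<close>.\<close>

definition l2_norm :: "(real \<Rightarrow> complex) \<Rightarrow> real" where
  "l2_norm u = sqrt (Re (l2_inner u u))"

definition l2_orthogonal :: "(real \<Rightarrow> complex) \<Rightarrow> (real \<Rightarrow> complex) \<Rightarrow> bool" where
  "l2_orthogonal u v \<longleftrightarrow> Re (l2_inner u v) = 0"

definition ph_curve :: "(real \<Rightarrow> complex) \<Rightarrow> real \<Rightarrow> complex" where
  "ph_curve w t = integral {0..t} (\<lambda>\<tau>. (w \<tau>)\<^sup>2)"

text \<open>The derivative is taken within \<open>{0..1}\<close>, since curves are only considered there.\<close>

definition arc_length :: "(real \<Rightarrow> complex) \<Rightarrow> real" where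
  "arc_length r = integral {0..1} (\<lambda>t. norm (vector_derivative r (at t within {0..1})))"

definition legendre :: "nat \<Rightarrow> real \<Rightarrow> real" where
  "legendre k t = sqrt (2 * real k + 1) *
     (\<Sum>i=0..k. (-1) ^ (k + i) * real (k choose i) * Bernstein k i t)"

text \<open>Unlike \<^const>\<open>sgn\<close>, this takes the value \<open>1\<close> at \<open>0\<close>.\<close>

definition sign1 :: "real \<Rightarrow> real" where
  "sign1 x = (if x \<ge> 0 then 1 else -1)"

definition euclid_norm :: "real Matrix.vec \<Rightarrow> real" where
  "euclid_norm v = sqrt (scalar_prod v v)"

definition outer_prod :: "real Matrix.vec \<Rightarrow> real Matrix.vec \<Rightarrow> real Matrix.mat" where
  "outer_prod u v = Matrix.mat (dim_vec u) (dim_vec v) (\<lambda>(i, j). vec_index u i * vec_index v j)"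

text \<open>The vector \<open>(Re c\<^sub>0, Im c\<^sub>0, \<dots>, Re c\<^sub>m, Im c\<^sub>m)\<close>.\<close>

definition coeff_vec :: "nat \<Rightarrow> (nat \<Rightarrow> complex) \<Rightarrow> real Matrix.vec" where
  "coeff_vec m c = Matrix.vec (2 * m + 2)
     (\<lambda>i. if even i then Re (c (i div 2)) else Im (c (i div 2)))"

definition householder_vec :: "nat \<Rightarrow> (nat \<Rightarrow> complex) \<Rightarrow> real Matrix.vec" where
  "householder_vec m c = coeff_vec m c
     + (sign1 (Re (c 0)) * euclid_norm (coeff_vec m c)) \<cdot>\<^sub>v unit_vec (2 * m + 2) 0"

definition householder_mat :: "nat \<Rightarrow> (nat \<Rightarrow> complex) \<Rightarrow> real Matrix.mat" where
  "householder_mat m c = (let g = householder_vec m c in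
     1\<^sub>m (2 * m + 2) - (2 / scalar_prod g g) \<cdot>\<^sub>m outer_prod g g)"

text \<open>Matrix entries are indexed from \<open>0\<close> here, so the entry \<open>(2 * j, k)\<close> is
  \<open>q\<close> at row \<open>2 * j + 1\<close> and column \<open>k + 1\<close> in the usual indexing from \<open>1\<close>.
  The index \<open>k\<close> ranges over \<open>{1..2 * m + 1}\<close>: column \<open>0\<close> is not used.\<close>

definition basis_coeff :: "nat \<Rightarrow> (nat \<Rightarrow> complex) \<Rightarrow> nat \<Rightarrow> nat \<Rightarrow> complex" where
  "basis_coeff m c k j =
     Complex (householder_mat m c $$ (2 * j, k)) (householder_mat m c $$ (2 * j + 1, k))"

end

theory Submission
  imports Defs
begin

text \<open>
  The polynomials \<^const>\<open>legendre\<close> are orthonormal on \<open>[0,1]\<close>, so integrals of products of complex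
  polynomials turn into finite sums over their Legendre coefficients
  (\<open>legendre_expansion_has_integral\<close>).  Since \<open>\<bar>r'\<bar> = \<bar>w\<^sup>2\<bar> = \<bar>w\<bar>\<^sup>2\<close>, the arc length is the squared
  norm of \<open>w\<close>, and hence the squared Euclidean norm of the real coefficient vector \<open>a\<close>.  The
  Householder matrix \<open>Q\<close> is the reflection that exchanges \<open>a\<close> with a multiple of the first unit
  vector.  It is orthogonal and its first column is parallel to \<open>a\<close>, so its other columns form an
  orthonormal basis of the complement of \<open>a\<close>: this is why the polynomials \<open>b k\<close> are orthonormal and
  orthogonal to \<open>w\<close>.  Pythagoras then gives the arc length of the perturbed curve, and
  expanding \<open>\<integral>(w + \<delta>w)\<^sup>2\<close>, which is bilinear and not sesquilinear, gives the end point condition.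

  Orthonormality of the Legendre polynomials rests on their moments.  The integral of
  \<open>t ^ p * legendre k t\<close> reduces, by the Beta integral, to an alternating binomial sum that equals
  \<open>p choose k\<close> by Vandermonde's identity for negative upper index.  It vanishes for \<open>p < k\<close>, and
  for \<open>p = k\<close> it combines with the leading coefficient \<open>sqrt (2 * k + 1) * (2 * k choose k)\<close> to give
  norm \<open>1\<close>.
\<close>

section \<open>Orthonormality of the Legendre polynomials\<close>

text \<open>Integrating the derivative of \<open>t ^ (a + 1) * (1 - t) ^ (b + 1)\<close>, which vanishes at both ends,
  and splitting \<open>1 = t + (1 - t)\<close>, gives a recursion in \<open>b\<close>.\<close>

lemma beta_integral:
  "integral {0..1} (\<lambda>t::real. t ^ a * (1 - t) ^ b) = fact a * fact b / fact (a + b + 1)"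
proof (induction b)
  case 0
  have "((\<lambda>t::real. t ^ a) has_integral (1 ^ Suc a / real (Suc a) - 0 ^ Suc a / real (Suc a))) {0..1}"
    by (rule fundamental_theorem_of_calculus)
      (auto intro!: derivative_eq_intros simp del: power_Suc of_nat_Suc
        simp flip: has_real_derivative_iff_has_vector_derivative)
  then show ?case
    by (simp add: integral_unique)
next
  case (Suc b)
  let ?I = "\<lambda>a b. integral {0..1} (\<lambda>t::real. t ^ a * (1 - t) ^ b)"
  have int: "(\<lambda>t::real. t ^ a * (1 - t) ^ b) integrable_on {0..1}" for a b
    by (intro integrable_continuous_interval continuous_intros)
  have "((\<lambda>t::real. real (Suc a) * (t ^ a * (1 - t) ^ Suc b) - real (Suc b) * (t ^ Suc a * (1 - t) ^ b))
      has_integral (1 ^ Suc a * (1 - 1) ^ Suc b - 0 ^ Suc a * (1 - 0) ^ Suc b)) {0..1}"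
    by (rule fundamental_theorem_of_calculus)
      (auto intro!: derivative_eq_intros
        simp: algebra_simps simp del: power_Suc of_nat_Suc
        simp flip: has_real_derivative_iff_has_vector_derivative)
  then have "integral {0..1} (\<lambda>t::real. real (Suc a) * (t ^ a * (1 - t) ^ Suc b)
      - real (Suc b) * (t ^ Suc a * (1 - t) ^ b)) = 0"
    by (simp add: integral_unique)
  then have parts: "real (Suc a) * ?I a (Suc b) = real (Suc b) * ?I (Suc a) b"
    using int[of a "Suc b"] int[of "Suc a" b]
    by (subst (asm) integral_diff) (auto intro!: integrable_on_mult_right simp del: power_Suc of_nat_Suc)
  have "?I a b = integral {0..1} (\<lambda>t::real. t ^ a * (1 - t) ^ Suc b + t ^ Suc a * (1 - t) ^ b)"
    by (simp add: algebra_simps)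
  also have "\<dots> = ?I a (Suc b) + ?I (Suc a) b"
    using int[of a "Suc b"] int[of "Suc a" b] by (rule integral_add)
  finally have split: "?I a b = ?I a (Suc b) + ?I (Suc a) b" .
  have "real (a + b + 2) * ?I a (Suc b) = real (Suc b) * ?I a (Suc b) + real (Suc a) * ?I a (Suc b)"
    by (simp add: algebra_simps)
  also have "\<dots> = real (Suc b) * ?I a b"
    unfolding parts split by (simp only: algebra_simps)
  finally have "real (a + b + 2) * ?I a (Suc b) = real (Suc b) * ?I a b" .
  then have "?I a (Suc b) = real (Suc b) * ?I a b / real (a + b + 2)"
    by (simp add: field_simps del: power_Suc)
  then show ?case
    by (simp add: Suc.IH field_simps del: power_Suc)
qed

text \<open>The sum is the \<open>k\<close>-th finite difference of \<open>i \<mapsto> (p + i) choose i\<close>.  Reading that coefficient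
  as \<open>\<plusminus>(-p - 1) gchoose i\<close> turns the sum into a Vandermonde convolution.\<close>

lemma alternating_binomial_sum:
  "(\<Sum>i=0..k. (-1) ^ (k + i) * real (k choose i) * real ((p + i) choose i)) = real (p choose k)"
proof -
  have neg: "(- real p - 1) gchoose i = (-1) ^ i * real ((p + i) choose i)" for i
    by (subst gbinomial_negated_upper) (simp add: binomial_gbinomial algebra_simps)
  have "(\<Sum>i=0..k. (-1) ^ (k + i) * real (k choose i) * real ((p + i) choose i))
      = (-1) ^ k * (\<Sum>i=0..k. ((- real p - 1) gchoose i) * (real k gchoose (k - i)))"
    unfolding sum_distrib_left
  proof (intro sum.cong refl)
    fix i assume "i \<in> {0..k}"
    then have "real k gchoose (k - i) = real (k choose i)"
      using binomial_symmetric[of i k] by (simp flip: binomial_gbinomial)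
    then show "(-1) ^ (k + i) * real (k choose i) * real ((p + i) choose i)
        = (-1) ^ k * (((- real p - 1) gchoose i) * (real k gchoose (k - i)))"
      by (simp add: neg power_add)
  qed
  also have "\<dots> = (-1) ^ k * ((- real p - 1 + real k) gchoose k)"
    by (simp only: gbinomial_Vandermonde)
  also have "\<dots> = real (p choose k)"
    by (subst gbinomial_negated_upper) (simp add: binomial_gbinomial flip: power_mult_distrib mult.assoc)
  finally show ?thesis .
qed

lemma continuous_on_legendre [continuous_intros]: "continuous_on A (legendre k)"
  unfolding legendre_def[abs_def] Bernstein_def by (intro continuous_intros)

lemma legendre_moment:
  "integral {0..1} (\<lambda>t. t ^ p * legendre k t)
    = sqrt (2 * real k + 1) * (fact p * fact k / fact (p + k + 1)) * real (p choose k)"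
proof -
  have "integral {0..1} (\<lambda>t. t ^ p * legendre k t)
      = integral {0..1} (\<lambda>t. \<Sum>i=0..k. sqrt (2 * real k + 1) * ((-1) ^ (k + i) * real (k choose i)
          * real (k choose i)) * (t ^ (p + i) * (1 - t) ^ (k - i)))"
    by (simp add: legendre_def Bernstein_def sum_distrib_left power_add mult_ac)
  also have "\<dots> = (\<Sum>i=0..k. sqrt (2 * real k + 1) * ((-1) ^ (k + i) * real (k choose i)
          * real (k choose i)) * (fact (p + i) * fact (k - i) / fact (p + i + (k - i) + 1)))"
    by (subst integral_sum)
      (auto intro!: integrable_continuous_interval continuous_intros simp: beta_integral)
  also have "\<dots> = (\<Sum>i=0..k. sqrt (2 * real k + 1) * (fact p * fact k / fact (p + k + 1)) *
        ((-1) ^ (k + i) * real (k choose i) * real ((p + i) choose i)))"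
    by (intro sum.cong refl)
      (simp add: binomial_fact[of _ "p + _"] binomial_fact[of _ k] mult_ac del: fact_Suc of_nat_Suc)
  also have "\<dots> = sqrt (2 * real k + 1) * (fact p * fact k / fact (p + k + 1)) * real (p choose k)"
    by (simp only: alternating_binomial_sum flip: sum_distrib_left)
  finally show ?thesis .
qed

text \<open>In \<open>Bernstein k i\<close> the coefficient of \<open>t ^ k\<close> is \<open>(-1) ^ (k - i) * (k choose i)\<close>, so all
  signs cancel in the leading coefficient, which becomes \<open>\<Sum>i. (k choose i)\<^sup>2\<close>.\<close>

lemma legendre_as_poly:
  obtains a :: "nat \<Rightarrow> real" where "\<And>t. legendre k t = (\<Sum>q\<le>k. a q * t ^ q)"
    and "a k = sqrt (2 * real k + 1) * real (2 * k choose k)"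
proof -
  define B :: "nat \<Rightarrow> real poly" where "B i = [:1, -1:] ^ (k - i) * Polynomial.monom 1 i" for i
  define P where "P = (\<Sum>i=0..k. Polynomial.smult (sqrt (2 * real k + 1) * ((-1) ^ (k + i) * real (k choose i)
      * real (k choose i))) (B i))"
  have deg: "Polynomial.degree (B i) = k" and lead: "Polynomial.coeff (B i) k = (-1) ^ (k - i)" if "i \<le> k" for i
  proof -
    show deg: "Polynomial.degree (B i) = k"
      unfolding B_def using that
      by (subst degree_mult_eq) (auto simp: degree_power_eq degree_monom_eq)
    have "Polynomial.coeff (B i) k = lead_coeff (B i)" by (simp add: deg)
    also have "\<dots> = (-1) ^ (k - i)"
      unfolding B_def lead_coeff_mult lead_coeff_power by (simp add: degree_monom_eq)
    finally show "Polynomial.coeff (B i) k = (-1) ^ (k - i)" .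
  qed
  have "Polynomial.degree P \<le> k"
    unfolding P_def by (intro degree_sum_le) (simp_all add: deg)
  then have "poly P t = (\<Sum>q\<le>k. Polynomial.coeff P q * t ^ q)" for t
    by (rule poly_as_sum_of_monoms'[THEN arg_cong[where f = "\<lambda>p. poly p t"], symmetric,
          unfolded poly_sum poly_monom])
  moreover have "poly P t = legendre k t" for t
    by (simp add: P_def B_def poly_sum poly_monom legendre_def Bernstein_def sum_distrib_left mult_ac)
  moreover have "Polynomial.coeff P k = sqrt (2 * real k + 1) * (\<Sum>i=0..k. real ((k choose i)\<^sup>2))"
    unfolding P_def coeff_sum sum_distrib_left
  proof (intro sum.cong refl)
    fix i assume "i \<in> {0..k}"
    moreover from this have "(-1::real) ^ (k + i) * (-1) ^ (k - i) = 1"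
      by (simp flip: power_add)
    ultimately show "Polynomial.coeff (Polynomial.smult (sqrt (2 * real k + 1) * ((-1) ^ (k + i) * real (k choose i)
        * real (k choose i))) (B i)) k = sqrt (2 * real k + 1) * real ((k choose i)\<^sup>2)"
      by (simp add: lead power2_eq_square mult_ac)
  qed
  then have "Polynomial.coeff P k = sqrt (2 * real k + 1) * real (2 * k choose k)"
    by (simp only: choose_square_sum atMost_atLeast0[symmetric] flip: of_nat_sum)
  ultimately show ?thesis using that[of "Polynomial.coeff P"] by simp
qed

lemma legendre_orthonormal_le:
  assumes "j \<le> k"
  shows "integral {0..1} (\<lambda>t. legendre j t * legendre k t) = (if j = k then 1 else 0)"
proof -
  obtain a where a: "\<And>t. legendre j t = (\<Sum>q\<le>j. a q * t ^ q)"
    and lead: "a j = sqrt (2 * real j + 1) * real (2 * j choose j)"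
    using legendre_as_poly by blast
  let ?M = "\<lambda>p. integral {0..1} (\<lambda>t. t ^ p * legendre k t)"
  have "integral {0..1} (\<lambda>t. legendre j t * legendre k t)
      = integral {0..1} (\<lambda>t. \<Sum>q\<le>j. a q * (t ^ q * legendre k t))"
    by (simp add: a sum_distrib_left mult_ac)
  also have "\<dots> = (\<Sum>q\<le>j. a q * ?M q)"
    by (subst integral_sum) (auto intro!: integrable_continuous_interval continuous_intros)
  also have "\<dots> = (\<Sum>q\<le>j. if q = j then a j * ?M j else 0)"
    using assms by (intro sum.cong) (auto simp: legendre_moment)
  also have "\<dots> = a j * ?M j" by simp
  also have "\<dots> = (if j = k then 1 else 0)"
  proof (cases "j = k")
    case True
    have "real (2 * k choose k) = fact (2 * k) / (fact k * fact k)"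
      by (simp add: binomial_fact)
    moreover have "fact (2 * k + 1) = (2 * real k + 1) * fact (2 * k)"
      by (simp add: fact_Suc)
    moreover have "2 * real k + 1 > 0" by simp
    ultimately have "(2 * real k + 1) * (real (2 * k choose k) * (fact k * fact k / fact (2 * k + 1))) = 1"
      by simp
    moreover have "sqrt (2 * real k + 1) * sqrt (2 * real k + 1) = 2 * real k + 1"
      by simp
    moreover have "a j * ?M j = (sqrt (2 * real k + 1) * sqrt (2 * real k + 1)) *
        (real (2 * k choose k) * (fact k * fact k / fact (2 * k + 1)))"
    proof -
      have "?M k = sqrt (2 * real k + 1) * (fact k * fact k / fact (2 * k + 1))"
        by (simp only: legendre_moment binomial_n_n of_nat_1 mult_1_right mult_2)
      then show ?thesis
        unfolding True lead[unfolded True] by (simp only: mult_ac)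
    qed
    ultimately have "a j * ?M j = 1"
      by (simp only:)
    then show ?thesis
      by (simp only: True if_True simp_thms)
  next
    case False
    then show ?thesis using assms by (simp add: legendre_moment)
  qed
  finally show ?thesis .
qed

lemma legendre_orthonormal:
  "integral {0..1} (\<lambda>t. legendre j t * legendre k t) = (if j = k then 1 else 0)"
  using legendre_orthonormal_le[of j k] legendre_orthonormal_le[of k j]
  by (cases "j \<le> k") (auto simp: mult.commute)

section \<open>Legendre expansions and PH curves\<close>

definition legendre_expansion :: "nat \<Rightarrow> (nat \<Rightarrow> complex) \<Rightarrow> real \<Rightarrow> complex" where
  "legendre_expansion m c t = (\<Sum>k=0..m. c k * of_real (legendre k t))"

lemma continuous_on_legendre_expansion [continuous_intros]:
  "continuous_on A (legendre_expansion m c)"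
  unfolding legendre_expansion_def[abs_def] by (intro continuous_intros)

lemma legendre_expansion_add:
  "legendre_expansion m c t + legendre_expansion m d t = legendre_expansion m (\<lambda>k. c k + d k) t"
  by (simp add: legendre_expansion_def sum.distrib algebra_simps)

text \<open>No conjugation appears here: this bilinear form serves the end point condition, and it yields
  the Hermitian inner product because the Legendre polynomials are real.\<close>

lemma legendre_expansion_has_integral:
  "((\<lambda>t. legendre_expansion m c t * legendre_expansion m d t) has_integral (\<Sum>k=0..m. c k * d k)) {0..1}"
proof -
  have single: "((\<lambda>t. c j * d k * of_real (legendre j t * legendre k t))
      has_integral c j * d k * of_real (if j = k then 1 else 0)) {0..1}" for j k
  proof (intro has_integral_mult_right has_integral_of_real)
    have "(\<lambda>t. legendre j t * legendre k t) integrable_on {0..1}"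
      by (intro integrable_continuous_interval continuous_intros)
    then show "((\<lambda>t. legendre j t * legendre k t) has_integral (if j = k then 1 else 0)) {0..1}"
      by (simp only: has_integral_integral legendre_orthonormal)
  qed
  have "((\<lambda>t. \<Sum>j=0..m. \<Sum>k=0..m. c j * d k * of_real (legendre j t * legendre k t))
      has_integral (\<Sum>j=0..m. \<Sum>k=0..m. c j * d k * of_real (if j = k then 1 else 0))) {0..1}"
    by (intro has_integral_sum single) auto
  also have "(\<Sum>j=0..m. \<Sum>k=0..m. c j * d k * of_real (if j = k then 1 else 0)) = (\<Sum>j=0..m. c j * d j)"
    by (simp add: if_distrib cong: if_cong)
  also have "(\<lambda>t. \<Sum>j=0..m. \<Sum>k=0..m. c j * d k * of_real (legendre j t * legendre k t))
      = (\<lambda>t. legendre_expansion m c t * legendre_expansion m d t)"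
    by (simp add: legendre_expansion_def sum_product mult_ac)
  finally show ?thesis .
qed

lemma l2_inner_legendre_expansion:
  "l2_inner (legendre_expansion m c) (legendre_expansion m d) = (\<Sum>k=0..m. c k * cnj (d k))"
proof -
  have "cnj (legendre_expansion m d t) = legendre_expansion m (\<lambda>k. cnj (d k)) t" for t
    by (simp add: legendre_expansion_def)
  then show ?thesis
    unfolding l2_inner_def by (simp add: integral_unique[OF legendre_expansion_has_integral])
qed

lemma Re_mult_cnj_self: "Re (z * cnj z) = (cmod z)\<^sup>2"
  by (simp add: cmod_power2 flip: power2_eq_square)

lemma Re_l2_inner_self:
  "Re (l2_inner (legendre_expansion m c) (legendre_expansion m c)) = (\<Sum>k=0..m. (cmod (c k))\<^sup>2)"
  unfolding l2_inner_legendre_expansion Re_sum Re_mult_cnj_self ..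

lemma l2_norm_legendre_expansion:
  "l2_norm (legendre_expansion m c) = sqrt (\<Sum>k=0..m. (cmod (c k))\<^sup>2)"
  by (simp add: l2_norm_def Re_l2_inner_self)

lemma ph_curve_1_legendre_expansion:
  "ph_curve (legendre_expansion m c) 1 = (\<Sum>k=0..m. (c k)\<^sup>2)"
  unfolding ph_curve_def
  using integral_unique[OF legendre_expansion_has_integral, of m c c] by (simp add: power2_eq_square)

text \<open>The parametric speed is the polynomial \<open>w * cnj w\<close>, so no square root is left under the
  integral.\<close>

lemma arc_length_ph_curve:
  assumes "continuous_on {0..1} w"
  shows "arc_length (ph_curve w) = Re (l2_inner w w)"
proof -
  have speed: "norm (vector_derivative (ph_curve w) (at t within {0..1})) = Re (w t * cnj (w t))"
    if "t \<in> {0..1}" for t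
  proof -
    have "(ph_curve w has_vector_derivative (w t)\<^sup>2) (at t within {0..1})"
      unfolding ph_curve_def[abs_def]
      by (rule integral_has_vector_derivative) (use assms that in \<open>auto intro!: continuous_intros\<close>)
    then have "vector_derivative (ph_curve w) (at t within {0..1}) = (w t)\<^sup>2"
      using that by (intro vector_derivative_within_cbox[of 0 1, unfolded cbox_interval]) auto
    then show ?thesis
      by (simp only: Re_mult_cnj_self norm_power)
  qed
  have int: "(\<lambda>t. w t * cnj (w t)) integrable_on {0..1}"
    using assms by (intro integrable_continuous_interval continuous_intros)
  have "arc_length (ph_curve w) = integral {0..1} (\<lambda>t. Re (w t * cnj (w t)))"
    unfolding arc_length_def by (intro integral_cong speed)
  also have "\<dots> = Re (l2_inner w w)"
    unfolding l2_inner_def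
    using has_integral_Re[OF integrable_integral[OF int]] by (rule integral_unique)
  finally show ?thesis .
qed

lemma arc_length_legendre_expansion:
  "arc_length (ph_curve (legendre_expansion m c)) = (\<Sum>k=0..m. (cmod (c k))\<^sup>2)"
  by (simp add: arc_length_ph_curve continuous_on_legendre_expansion Re_l2_inner_self)

section \<open>Householder reflections\<close>

text \<open>In the product of two columns the rank one terms contribute \<open>-2 - 2 + 4 = 0\<close> copies of
  \<open>g j * g k / G\<close>, so only the product of the two unit vectors is left.\<close>

lemma householder_columns_orthonormal:
  fixes g :: "'a \<Rightarrow> real"
  assumes "finite N" "j \<in> N" "k \<in> N"
    and G: "G = (\<Sum>i\<in>N. g i * g i)" "G \<noteq> 0"
    and q: "\<And>i k. i \<in> N \<Longrightarrow> k \<in> N \<Longrightarrow> q i k = (if i = k then 1 else 0) - 2 / G * (g i * g k)"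
  shows "(\<Sum>i\<in>N. q i j * q i k) = (if j = k then 1 else 0)"
proof -
  have "(\<Sum>i\<in>N. q i j * q i k)
      = (\<Sum>i\<in>N. (if i = j then if j = k then 1 else 0 else 0) - (if i = j then 2 / G * (g j * g k) else 0)
          - (if i = k then 2 / G * (g k * g j) else 0) + 4 / G\<^sup>2 * g j * g k * (g i * g i))"
    by (intro sum.cong) (auto simp: q assms algebra_simps power2_eq_square)
  also have "\<dots> = (if j = k then 1 else 0) - 2 / G * (g j * g k) - 2 / G * (g k * g j)
      + 4 / G\<^sup>2 * g j * g k * G"
    using assms by (simp add: sum.distrib sum_subtractf flip: sum_distrib_left sum_divide_distrib)
  also have "\<dots> = (if j = k then 1 else 0)"
    using G(2) by (simp add: power2_eq_square)
  finally show ?thesis .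
qed

text \<open>When \<open>g \<bullet> g = 2 * (g \<bullet> a)\<close>, the reflection maps \<open>a\<close> to \<open>a - g\<close>.  So column \<open>k\<close> is orthogonal
  to \<open>a\<close> wherever \<open>a\<close> and \<open>g\<close> agree.\<close>

lemma householder_column_orthogonal:
  fixes g a :: "'a \<Rightarrow> real"
  assumes "finite N" "k \<in> N" "g k = a k"
    and G: "G = (\<Sum>i\<in>N. g i * g i)" "G \<noteq> 0" "G = 2 * (\<Sum>i\<in>N. g i * a i)"
    and q: "\<And>i k. i \<in> N \<Longrightarrow> k \<in> N \<Longrightarrow> q i k = (if i = k then 1 else 0) - 2 / G * (g i * g k)"
  shows "(\<Sum>i\<in>N. q i k * a i) = 0"
proof -
  have "(\<Sum>i\<in>N. q i k * a i) = (\<Sum>i\<in>N. (if i = k then a k else 0) - 2 / G * g k * (g i * a i))"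
    by (intro sum.cong) (auto simp: q assms algebra_simps)
  also have "\<dots> = a k - g k / G * (2 * (\<Sum>i\<in>N. g i * a i))"
    using assms(1,2) by (simp add: sum_subtractf flip: sum_distrib_left sum_divide_distrib)
  also have "\<dots> = a k - g k / G * G"
    by (simp only: G(3)[symmetric])
  also have "\<dots> = 0"
    using G(2) assms(3) by simp
  finally show ?thesis .
qed

text \<open>The sign in \<open>g\<close> is the one that avoids cancellation: \<open>sign1 (a 0) * a 0 \<ge> 0\<close>, hence
  \<open>g \<bullet> a \<ge> a \<bullet> a > 0\<close>.  The relation \<open>g \<bullet> g = 2 * (g \<bullet> a)\<close> expresses that \<open>g - a\<close> has the same
  length as \<open>a\<close>.\<close>

lemma householder_vec_inner:
  fixes g a :: "nat \<Rightarrow> real"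
  assumes "n > 0" and A: "A = (\<Sum>i<n. a i * a i)" "A \<noteq> 0"
    and g: "\<And>i. i < n \<Longrightarrow> g i = a i + (if i = 0 then sign1 (a 0) * sqrt A else 0)"
  shows "(\<Sum>i<n. g i * g i) = 2 * (\<Sum>i<n. g i * a i)" and "(\<Sum>i<n. g i * g i) \<noteq> 0"
proof -
  let ?s = "sign1 (a 0) * sqrt A"
  have pos: "A > 0" using A by (simp add: sum_nonneg order_less_le)
  have s2: "?s * ?s = A" using pos by (simp add: sign1_def)
  have "(\<Sum>i<n. g i * a i) = (\<Sum>i<n. a i * a i + (if i = 0 then ?s * a 0 else 0))"
    by (intro sum.cong) (auto simp: g algebra_simps)
  then have ga: "(\<Sum>i<n. g i * a i) = A + ?s * a 0"
    using \<open>n > 0\<close> by (simp add: sum.distrib A)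
  have "(\<Sum>i<n. g i * g i) = (\<Sum>i<n. a i * a i + (if i = 0 then 2 * (?s * a 0) + ?s * ?s else 0))"
    by (intro sum.cong) (auto simp: g algebra_simps)
  then have gg: "(\<Sum>i<n. g i * g i) = A + 2 * (?s * a 0) + A"
    using \<open>n > 0\<close> unfolding s2 by (simp add: sum.distrib A)
  have "?s * a 0 \<ge> 0" using pos by (auto simp: sign1_def mult_nonneg_nonneg mult_nonneg_nonpos)
  with ga gg pos show "(\<Sum>i<n. g i * g i) = 2 * (\<Sum>i<n. g i * a i)" "(\<Sum>i<n. g i * g i) \<noteq> 0"
    by auto
qed

section \<open>The orthonormal basis of the complement\<close>

text \<open>Even indices carry the real parts and odd indices the imaginary parts of the coefficients.\<close>

lemma sum_even_odd:
  fixes f :: "nat \<Rightarrow> 'a::comm_monoid_add"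
  shows "(\<Sum>i<2*m+2. f i) = (\<Sum>j=0..m. f (2 * j) + f (2 * j + 1))"
  by (induction m) (simp_all add: numeral_2_eq_2 add.assoc)

context
  fixes m :: nat and c :: "nat \<Rightarrow> complex"
  assumes nonzero: "\<exists>k\<le>m. c k \<noteq> 0"
begin

private definition "a i = vec_index (coeff_vec m c) i"
private definition "g i = vec_index (householder_vec m c) i"
private definition "G = (\<Sum>i<2*m+2. g i * g i)"

private lemma coeff_norm: "(\<Sum>i<2*m+2. a i * a i) = (\<Sum>k=0..m. (cmod (c k))\<^sup>2)"
  unfolding sum_even_odd by (simp add: a_def coeff_vec_def cmod_power2 flip: power2_eq_square)

private lemma coeff_norm_nonzero: "(\<Sum>i<2*m+2. a i * a i) \<noteq> 0"
  unfolding coeff_norm using nonzero by (subst sum_nonneg_eq_0_iff) auto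

private lemma euclid_norm_coeff_vec: "euclid_norm (coeff_vec m c) = sqrt (\<Sum>i<2*m+2. a i * a i)"
  by (simp add: euclid_norm_def scalar_prod_def a_def atLeast0LessThan coeff_vec_def)

private lemma householder_vec_entry:
  assumes "i < 2 * m + 2"
  shows "g i = a i + (if i = 0 then sign1 (a 0) * sqrt (\<Sum>i<2*m+2. a i * a i) else 0)"
  using assms
  by (simp add: g_def householder_vec_def euclid_norm_coeff_vec)
     (simp add: a_def coeff_vec_def)

private lemma G_props: "G = 2 * (\<Sum>i<2*m+2. g i * a i)" "G \<noteq> 0"
  unfolding G_def
  using householder_vec_inner[OF _ refl coeff_norm_nonzero householder_vec_entry] by auto

private lemma householder_mat_entry:
  assumes "i < 2 * m + 2" "k < 2 * m + 2"
  shows "householder_mat m c $$ (i, k) = (if i = k then 1 else 0) - 2 / G * (g i * g k)"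
proof -
  have dim: "dim_vec (householder_vec m c) = 2 * m + 2"
    by (simp add: householder_vec_def)
  have "scalar_prod (householder_vec m c) (householder_vec m c) = G"
    by (simp add: scalar_prod_def dim G_def g_def atLeast0LessThan)
  then show ?thesis
    using assms by (simp add: householder_mat_def Let_def outer_prod_def dim g_def)
qed

lemma basis_coeff_orthonormal:
  assumes "j \<le> 2 * m + 1" "k \<le> 2 * m + 1"
  shows "(\<Sum>l=0..m. Re (basis_coeff m c j l * cnj (basis_coeff m c k l))) = (if j = k then 1 else 0)"
proof -
  let ?q = "\<lambda>i k. householder_mat m c $$ (i, k)"
  have "(\<Sum>l=0..m. Re (basis_coeff m c j l * cnj (basis_coeff m c k l)))
      = (\<Sum>i<2*m+2. ?q i j * ?q i k)"
    unfolding sum_even_odd by (simp add: basis_coeff_def)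
  also have "\<dots> = (if j = k then 1 else 0)"
    using assms
    by (intro householder_columns_orthonormal[OF _ _ _ G_def G_props(2)]) (auto simp: householder_mat_entry)
  finally show ?thesis .
qed

text \<open>Column \<open>0\<close> must be left out: there \<open>g\<close> differs from the coefficient vector.\<close>

lemma basis_coeff_orthogonal:
  assumes "k \<in> {1..2*m+1}"
  shows "(\<Sum>l=0..m. Re (basis_coeff m c k l * cnj (c l))) = 0"
proof -
  let ?q = "\<lambda>i k. householder_mat m c $$ (i, k)"
  have "(\<Sum>l=0..m. Re (basis_coeff m c k l * cnj (c l))) = (\<Sum>i<2*m+2. ?q i k * a i)"
    unfolding sum_even_odd by (simp add: basis_coeff_def a_def coeff_vec_def)
  also have "\<dots> = 0"
    using assms
    by (intro householder_column_orthogonal[OF _ _ _ G_def G_props(2,1)])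
      (auto simp: householder_mat_entry householder_vec_entry)
  finally show ?thesis .
qed

end

section \<open>Arc length and end points of the perturbed curve\<close>

theorem mainTheorem1:
  fixes m :: nat
    and c :: "nat \<Rightarrow> complex"
    and \<gamma> :: "nat \<Rightarrow> real"
    and w \<delta>w r :: "real \<Rightarrow> complex"
    and b :: "nat \<Rightarrow> real \<Rightarrow> complex"
    and bc :: "nat \<Rightarrow> nat \<Rightarrow> complex"
    and S :: real
  assumes w: "w = (\<lambda>t. \<Sum>k=0..m. c k * of_real (legendre k t))"
    and nonzero: "w \<noteq> (\<lambda>t. 0)"
    and r: "r = ph_curve w"
    and S: "S = arc_length r"
    and bc: "bc = basis_coeff m c"
    and b: "b = (\<lambda>k t. \<Sum>j=0..m. bc k j * of_real (legendre j t))"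
    and \<delta>w: "\<delta>w = (\<lambda>t. \<Sum>k=1..2*m+1. of_real (\<gamma> k) * b k t)"
  shows "S = (l2_norm w)\<^sup>2
    \<and> (l2_orthogonal \<delta>w w \<and> l2_norm \<delta>w = sqrt (\<Sum>k=1..2*m+1. (\<gamma> k)\<^sup>2))
    \<and> (\<forall>\<delta>S>0. (\<Sum>k=1..2*m+1. (\<gamma> k)\<^sup>2) = \<delta>S \<longrightarrow>
           arc_length (ph_curve (\<lambda>t. w t + \<delta>w t)) = S + \<delta>S)
    \<and> (r 1 = 1 \<longrightarrow>
           ((ph_curve (\<lambda>t. w t + \<delta>w t) 0 = r 0 \<and> ph_curve (\<lambda>t. w t + \<delta>w t) 1 = r 1) \<longleftrightarrow>
            (\<Sum>j=1..2*m+1. \<Sum>k=1..2*m+1.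
                (\<Sum>l=0..m. bc j l * bc k l) * of_real (\<gamma> j) * of_real (\<gamma> k))
            + (\<Sum>k=1..2*m+1. (2 * (\<Sum>l=0..m. bc k l * c l)) * of_real (\<gamma> k)) = 0))"
proof -
  define N where "N = {1..2*m+1}"
  have fin: "finite N" by (simp add: N_def)
  define d where "d l = (\<Sum>k\<in>N. of_real (\<gamma> k) * bc k l)" for l
  have w': "w = legendre_expansion m c"
    by (simp add: w legendre_expansion_def fun_eq_iff)
  have \<delta>w': "\<delta>w = legendre_expansion m d"
  proof
    fix t
    have "\<delta>w t = (\<Sum>k\<in>N. \<Sum>j=0..m. of_real (\<gamma> k) * bc k j * of_real (legendre j t))"
      by (simp add: \<delta>w b N_def sum_distrib_left mult_ac)
    also have "\<dots> = (\<Sum>j=0..m. \<Sum>k\<in>N. of_real (\<gamma> k) * bc k j * of_real (legendre j t))"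
      by (rule sum.swap)
    finally show "\<delta>w t = legendre_expansion m d t"
      by (simp add: legendre_expansion_def d_def sum_distrib_right)
  qed
  have sum': "(\<lambda>t. w t + \<delta>w t) = legendre_expansion m (\<lambda>k. c k + d k)"
    by (simp add: w' \<delta>w' legendre_expansion_add)
  have c0: "\<exists>k\<le>m. c k \<noteq> 0"
    using nonzero by (force simp: w)

  have "(\<Sum>l=0..m. Re (d l * cnj (c l)))
      = (\<Sum>l=0..m. \<Sum>k\<in>N. \<gamma> k * Re (bc k l * cnj (c l)))"
    by (simp add: d_def sum_distrib_right mult.assoc)
  also have "\<dots> = (\<Sum>k\<in>N. \<gamma> k * (\<Sum>l=0..m. Re (bc k l * cnj (c l))))"
    unfolding sum_distrib_left by (rule sum.swap)
  also have "\<dots> = 0"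
    using basis_coeff_orthogonal[OF c0] by (simp add: bc N_def)
  finally have orth: "(\<Sum>l=0..m. Re (d l * cnj (c l))) = 0" .

  have "(\<Sum>l=0..m. (cmod (d l))\<^sup>2)
      = (\<Sum>l=0..m. Re ((\<Sum>j\<in>N. of_real (\<gamma> j) * bc j l) * (\<Sum>k\<in>N. of_real (\<gamma> k) * cnj (bc k l))))"
  proof (intro sum.cong refl)
    fix l
    show "(cmod (d l))\<^sup>2
        = Re ((\<Sum>j\<in>N. of_real (\<gamma> j) * bc j l) * (\<Sum>k\<in>N. of_real (\<gamma> k) * cnj (bc k l)))"
      by (simp add: d_def flip: Re_mult_cnj_self)
  qed
  also have "\<dots> = (\<Sum>l=0..m. \<Sum>j\<in>N. \<Sum>k\<in>N. \<gamma> j * \<gamma> k * Re (bc j l * cnj (bc k l)))"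
    by (intro sum.cong refl) (simp add: sum_product algebra_simps)
  also have "\<dots> = (\<Sum>j\<in>N. \<Sum>k\<in>N. \<gamma> j * \<gamma> k * (\<Sum>l=0..m. Re (bc j l * cnj (bc k l))))"
    unfolding sum_distrib_left by (subst sum.swap) (intro sum.cong refl sum.swap)
  also have "\<dots> = (\<Sum>j\<in>N. \<Sum>k\<in>N. if j = k then (\<gamma> k)\<^sup>2 else 0)"
  proof (intro sum.cong refl)
    fix j k assume "j \<in> N" "k \<in> N"
    then have "(\<Sum>l=0..m. Re (bc j l * cnj (bc k l))) = (if j = k then 1 else 0)"
      unfolding bc N_def by (intro basis_coeff_orthonormal[OF c0]) auto
    then show "\<gamma> j * \<gamma> k * (\<Sum>l=0..m. Re (bc j l * cnj (bc k l))) = (if j = k then (\<gamma> k)\<^sup>2 else 0)"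
      by (simp only:) (simp add: power2_eq_square)
  qed
  also have "\<dots> = (\<Sum>k\<in>N. (\<gamma> k)\<^sup>2)"
    using fin by simp
  finally have norm_d: "(\<Sum>l=0..m. (cmod (d l))\<^sup>2) = (\<Sum>k\<in>N. (\<gamma> k)\<^sup>2)" .

  have S': "S = (\<Sum>k=0..m. (cmod (c k))\<^sup>2)"
    by (simp add: S r w' arc_length_legendre_expansion)
  have 1: "S = (l2_norm w)\<^sup>2"
    by (simp add: S' w' l2_norm_legendre_expansion sum_nonneg)
  have 2: "l2_orthogonal \<delta>w w" "l2_norm \<delta>w = sqrt (\<Sum>k\<in>N. (\<gamma> k)\<^sup>2)"
    using orth by (simp_all add: l2_orthogonal_def w' \<delta>w' l2_inner_legendre_expansion
        l2_norm_legendre_expansion norm_d)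

  have "(\<Sum>l=0..m. (cmod (c l + d l))\<^sup>2)
      = (\<Sum>l=0..m. (cmod (c l))\<^sup>2 + (cmod (d l))\<^sup>2 + 2 * Re (d l * cnj (c l)))"
    by (intro sum.cong refl) (simp add: cmod_power2 power2_sum algebra_simps)
  also have "\<dots> = S + (\<Sum>k\<in>N. (\<gamma> k)\<^sup>2)"
    by (simp only: sum.distrib norm_d orth S' mult_zero_right add_0_right flip: sum_distrib_left)
  finally have 3: "arc_length (ph_curve (\<lambda>t. w t + \<delta>w t)) = S + (\<Sum>k\<in>N. (\<gamma> k)\<^sup>2)"
    unfolding sum' arc_length_legendre_expansion .

  have dd: "(\<Sum>l=0..m. (d l)\<^sup>2)
      = (\<Sum>j\<in>N. \<Sum>k\<in>N. (\<Sum>l=0..m. bc j l * bc k l) * of_real (\<gamma> j) * of_real (\<gamma> k))"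
  proof -
    have "(\<Sum>l=0..m. (d l)\<^sup>2)
        = (\<Sum>l=0..m. \<Sum>j\<in>N. \<Sum>k\<in>N. bc j l * bc k l * of_real (\<gamma> j) * of_real (\<gamma> k))"
      by (intro sum.cong refl) (simp add: d_def power2_eq_square sum_product mult_ac)
    also have "\<dots> = (\<Sum>j\<in>N. \<Sum>k\<in>N. \<Sum>l=0..m. bc j l * bc k l * of_real (\<gamma> j) * of_real (\<gamma> k))"
      by (subst sum.swap) (intro sum.cong refl sum.swap)
    finally show ?thesis by (simp add: sum_distrib_right)
  qed
  have cd: "2 * (\<Sum>l=0..m. c l * d l) = (\<Sum>k\<in>N. (2 * (\<Sum>l=0..m. bc k l * c l)) * of_real (\<gamma> k))"
  proof -
    have "2 * (\<Sum>l=0..m. c l * d l) = (\<Sum>l=0..m. \<Sum>k\<in>N. 2 * (bc k l * c l) * of_real (\<gamma> k))"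
      by (simp add: d_def sum_distrib_left mult_ac)
    also have "\<dots> = (\<Sum>k\<in>N. \<Sum>l=0..m. 2 * (bc k l * c l) * of_real (\<gamma> k))"
      by (rule sum.swap)
    finally show ?thesis by (simp add: sum_distrib_left sum_distrib_right)
  qed
  have "(\<Sum>l=0..m. (c l + d l)\<^sup>2) = (\<Sum>l=0..m. (c l)\<^sup>2 + (d l)\<^sup>2 + 2 * (c l * d l))"
    by (intro sum.cong refl) (simp add: power2_eq_square algebra_simps)
  also have "\<dots> = (\<Sum>l=0..m. (c l)\<^sup>2) + ((\<Sum>l=0..m. (d l)\<^sup>2) + 2 * (\<Sum>l=0..m. c l * d l))"
    by (simp only: sum.distrib add.assoc flip: sum_distrib_left)
  finally have end_point: "ph_curve (\<lambda>t. w t + \<delta>w t) 1 = r 1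
      + ((\<Sum>j\<in>N. \<Sum>k\<in>N. (\<Sum>l=0..m. bc j l * bc k l) * of_real (\<gamma> j) * of_real (\<gamma> k))
        + (\<Sum>k\<in>N. (2 * (\<Sum>l=0..m. bc k l * c l)) * of_real (\<gamma> k)))"
    unfolding sum' unfolding r w' ph_curve_1_legendre_expansion dd cd .
  have start: "ph_curve u 0 = 0" for u
    by (simp add: ph_curve_def)
  have 4: "(ph_curve (\<lambda>t. w t + \<delta>w t) 0 = r 0 \<and> ph_curve (\<lambda>t. w t + \<delta>w t) 1 = r 1) \<longleftrightarrow>
      (\<Sum>j\<in>N. \<Sum>k\<in>N. (\<Sum>l=0..m. bc j l * bc k l) * of_real (\<gamma> j) * of_real (\<gamma> k))
        + (\<Sum>k\<in>N. (2 * (\<Sum>l=0..m. bc k l * c l)) * of_real (\<gamma> k)) = 0"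
    unfolding end_point by (simp add: start r)
  show ?thesis
    using 1 2 3 4 unfolding N_def by blast
qed

end
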